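(* Let $\epsilon>0$, let $\mathcal{N}$ be the finite set of indices of the nodes of a graph (the game positions), and let $\mathcal{I}\subset\mathcal{N}$ be the set of indices of the interior (running) nodes. For a real-valued function $u=(u_i)_{i\in\mathcal{N}}$ and $i\in\mathcal{I}$ put $$\mathcal{G}^i[u]:=\min\left\{ u_i-\min_{j\in\{i'\}}u_j-\epsilon,\ u_i-\frac{1}{2}\left(\max_{j\in\{i'\}}u_j+\min_{j\in\{i'\}}u_j\right)\right\},$$ where $\{i'\}$ denotes the set of indices of the neighbors of node $i$ in the graph. Let $u$ and $v$ be respectively a subsolution and a supersolution of $\mathcal{G}^i[\cdot]=0$, i.e. $\mathcal{G}^i[u]\leq 0\leq\mathcal{G}^i[v]$ for all $i\in\mathcal{I}$. Assume also that $v_i$ is bounded from above for all $i\in\mathcal{N}$ and from below for all $i\in\mathcal{N}\setminus\mathcal{I}$, and that $u_i\leq v_i$ for all $i\in\mathcal{N}\setminus\mathcal{I}$. Then $u_i\leq v_i$ for all $i\in\mathcal{N}$.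
   Context: The graph is a finite undirected graph with node set indexed by $\mathcal{N}$. Nodes with index in $\mathcal{I}$ are called interior or running nodes; those with index in $\mathcal{N}\setminus\mathcal{I}$ are terminal nodes. For each $i\in\mathcal{I}$ the set $\{i'\}\subset\mathcal{N}$ of indices of nodes adjacent to node $i$ is finite and nonempty (so that the max and min are defined). *)

theory Defs
  imports Complex_Main "Graph_Theory.Digraph"
begin

definition neighbors :: "('a, 'b) pre_digraph \<Rightarrow> 'a \<Rightarrow> 'a set" where
  "neighbors G i = {j. i \<rightarrow>\<^bsub>G\<^esub> j}"

text \<open>
  The operator $\mathcal{G}^i[u]$. The inner minimum and maximum are meaningful only if
  the neighbor set of \<open>i\<close> is finite and nonempty.
\<close>
definition game_op :: "('a, 'b) pre_digraph \<Rightarrow> real \<Rightarrow> 'a \<Rightarrow> ('a \<Rightarrow> real) \<Rightarrow> real" where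
  "game_op G \<epsilon> i u =
     min (u i - Min (u ` neighbors G i) - \<epsilon>)
         (u i - 1/2 * (Max (u ` neighbors G i) + Min (u ` neighbors G i)))"

definition subsolution :: "('a, 'b) pre_digraph \<Rightarrow> real \<Rightarrow> 'a set \<Rightarrow> ('a \<Rightarrow> real) \<Rightarrow> bool" where
  "subsolution G \<epsilon> I u \<longleftrightarrow> (\<forall>i\<in>I. game_op G \<epsilon> i u \<le> 0)"

definition supersolution :: "('a, 'b) pre_digraph \<Rightarrow> real \<Rightarrow> 'a set \<Rightarrow> ('a \<Rightarrow> real) \<Rightarrow> bool" where
  "supersolution G \<epsilon> I v \<longleftrightarrow> (\<forall>i\<in>I. 0 \<le> game_op G \<epsilon> i v)"

end

theory Submission
  imports Defs
begin

text \<open>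
  If \<open>u - v\<close> attains its positive maximum at \<open>i\<close>, then it also attains it at every neighbor
  minimizing \<open>v\<close>, where the supersolution property makes \<open>v\<close> smaller by at least \<open>\<epsilon>\<close>. Among the
  finitely many maximum points of \<open>u - v\<close>, one minimizing \<open>v\<close> is therefore contradictory.
\<close>

lemma game_op_argmin_step:
  fixes u v :: "'a \<Rightarrow> real"
  assumes fin: "finite (neighbors G i)" and ne: "neighbors G i \<noteq> {}"
    and sub: "game_op G \<epsilon> i u \<le> 0" and super: "0 \<le> game_op G \<epsilon> i v"
    and le: "\<And>j. j \<in> neighbors G i \<Longrightarrow> u j - v j \<le> u i - v i"
  obtains j where "j \<in> neighbors G i" "u j - v j = u i - v i" "v j \<le> v i - \<epsilon>"
proof -
  let ?N = "neighbors G i"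
  have "Min (v ` ?N) \<in> v ` ?N"
    using fin ne by simp
  then obtain j where j: "j \<in> ?N" "v j = Min (v ` ?N)"
    by auto
  have v: "v j + \<epsilon> \<le> v i" "v j + Max (v ` ?N) \<le> 2 * v i"
    using super j(2) by (simp_all add: game_op_def)
  have min_u: "Min (u ` ?N) \<le> u j"
    using fin j(1) by simp
  \<comment> \<open>By \<open>le\<close>, \<open>u\<close> lies below \<open>v\<close> shifted by
    the constant \<open>u i - v i\<close> at each neighbor, so the maxima compare with the same
    shift.\<close>
  have max_u: "Max (u ` ?N) \<le> Max (v ` ?N) + (u i - v i)"
  proof -
    have "u k \<le> Max (v ` ?N) + (u i - v i)" if "k \<in> ?N" for k
    proof -
      have "v k \<le> Max (v ` ?N)"
        using fin that by simp
      then show ?thesis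
        using le[OF that] by linarith
    qed
    then show ?thesis
      using fin ne by simp
  qed
  \<comment> \<open>A minimum being nonpositive yields only one of two inequalities, whereas
    \<open>super\<close> yielded both; whichever holds for \<open>u\<close> can thus be matched with
    its counterpart for \<open>v\<close>.\<close>
  have "u i \<le> Min (u ` ?N) + \<epsilon> \<or> 2 * u i \<le> Max (u ` ?N) + Min (u ` ?N)"
    using sub by (auto simp: game_op_def min_le_iff_disj)
  \<comment> \<open>In the first case \<open>\<epsilon>\<close> cancels on subtracting. In the
    second, subtracting gives 2 (\<open>u i - v i\<close>) \<le> (\<open>u i - v i\<close>) +
    (\<open>u j - v j\<close>) by \<open>max_u\<close> and \<open>min_u\<close>.\<close>
  then have "u i - v i \<le> u j - v j"
    using v min_u max_u by linarith
  with le[OF j(1)] have "u j - v j = u i - v i"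
    by linarith
  with j(1) v(1) show thesis
    by (intro that[of j]) auto
qed

theorem theorem1p2:
  fixes G :: "('a, 'b) pre_digraph"
    and I :: "'a set"
    and \<epsilon> :: real
    and u v :: "'a \<Rightarrow> real"
  assumes "\<epsilon> > 0"
    and "pseudo_graph G"
    and "I \<subseteq> verts G"
    and "\<forall>i\<in>I. neighbors G i \<noteq> {}"
    and "subsolution G \<epsilon> I u"
    and "supersolution G \<epsilon> I v"
    and "bdd_above (v ` verts G)"
    and "bdd_below (v ` (verts G - I))"
    and "\<forall>i\<in>verts G - I. u i \<le> v i"
  shows "\<forall>i\<in>verts G. u i \<le> v i"
proof (rule ccontr)
  assume "\<not> ?thesis"
  then obtain i0 where i0: "i0 \<in> verts G" "v i0 < u i0"
    by force
  interpret pseudo_graph G by fact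
  have N_sub: "neighbors G i \<subseteq> verts G" for i
    by (auto simp: neighbors_def dest: adj_in_verts)
  \<comment> \<open>The maximum runs over terminal nodes too, since a neighbor of a running node may
    be terminal.\<close>
  define M where "M = Max ((\<lambda>i. u i - v i) ` verts G)"
  have M_ge: "u i - v i \<le> M" if "i \<in> verts G" for i
    using that by (simp add: M_def)
  have M_pos: "M > 0"
    using M_ge[OF i0(1)] i0(2) by linarith
  define S where "S = {i \<in> verts G. u i - v i = M}"
  have "M \<in> (\<lambda>i. u i - v i) ` verts G"
    unfolding M_def using i0(1) by (intro Max_in) auto
  then have "S \<noteq> {}" "finite S"
    by (auto simp: S_def)
  then obtain i where i: "i \<in> S" "\<And>j. j \<in> S \<Longrightarrow> v i \<le> v j"
    using ex_min_if_finite[of "v ` S"] by force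
  \<comment> \<open>At terminal nodes \<open>u - v\<close> is at most 0, hence below
    \<open>M\<close>.\<close>
  have iI: "i \<in> I"
  proof (rule ccontr)
    assume "i \<notin> I"
    then have "u i \<le> v i"
      using assms(9) i(1) by (simp add: S_def)
    with i(1) M_pos show False
      by (simp add: S_def)
  qed
  have fin: "finite (neighbors G i)"
    using N_sub finite_verts by (rule finite_subset)
  have le: "u j - v j \<le> u i - v i" if "j \<in> neighbors G i" for j
    using M_ge[of j] N_sub that i(1) by (auto simp: S_def)
  have "neighbors G i \<noteq> {}" "game_op G \<epsilon> i u \<le> 0" "0 \<le> game_op G \<epsilon> i v"
    using assms(4-6) iI by (auto simp: subsolution_def supersolution_def)
  then obtain j where j: "j \<in> neighbors G i" "u j - v j = u i - v i" "v j \<le> v i - \<epsilon>"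
    using game_op_argmin_step[where G = G and i = i and u = u and v = v] fin le by blast
  \<comment> \<open>The neighbor \<open>j\<close> is again a maximum point, so the choice of
    \<open>i\<close> forces \<open>v i \<le> v j\<close>, against a drop of at least
    \<open>\<epsilon> > 0\<close>.\<close>
  have "j \<in> S"
    using j(1,2) N_sub i(1) by (auto simp: S_def)
  with i(2) j(3) assms(1) show False
    by fastforce
qed

end
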